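(* Let $\mathbf X=\beta\,\mathbf v_0^{\otimes k}+\mathbf Z\in\bigotimes^k\mathbb R^n$, where $\mathbf v_0\in\mathbb S^{n-1}$ is an unknown unit vector and $\mathbf Z$ is a symmetric standard normal noise tensor. For any estimator $\widehat{\mathbf v}=\widehat{\mathbf v}(\mathbf X)$ of $\mathbf v_0$ from data $\mathbf X$ such that $\|\widehat{\mathbf v}(\mathbf X)\|_2=1$ (i.e. $\widehat{\mathbf v}:\bigotimes^k\mathbb R^n\to\mathbb S^{n-1}$), we have, for all $n\ge4$, $$\beta\le\sqrt{\frac{k}{10}}\quad\Longrightarrow\quad\mathbb E\,\mathrm{Loss}(\widehat{\mathbf v},\mathbf v_0)\ge\frac1{32}.$$
   Context: $k$ is the order of the tensor and $\beta\ge0$ is the signal-to-noise ratio. $\mathbb S^{n-1}=\{\mathbf x\in\mathbb R^n:\|\mathbf x\|_2=1\}$, and $\mathbf v^{\otimes k}\in\bigotimes^k\mathbb R^n$ has entries $\mathbf v_{i_1}\cdots\mathbf v_{i_k}$. The symmetric standard normal noise tensor $\mathbf Z\in\bigotimes^k\mathbb R^n$ is defined by $$\mathbf Z_{i_1,\dots,i_k}=\frac1{k!}\sqrt{\frac kn}\sum_{\pi\in\mathfrak S_k}\mathbf G_{i_{\pi(1)},\dots,i_{\pi(k)}},$$ where $\mathbf G\in\bigotimes^k\mathbb R^n$ has i.i.d. $\mathsf N(0,1)$ entries and $\mathfrak S_k$ is the group of permutations of $\{1,\dots,k\}$. For unit vectors, $\mathrm{Loss}(\widehat{\mathbf v},\mathbf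 v_0)=\min(\|\widehat{\mathbf v}-\mathbf v_0\|_2^2,\|\widehat{\mathbf v}+\mathbf v_0\|_2^2)=2-2|\langle\widehat{\mathbf v},\mathbf v_0\rangle|$. *)

theory Defs
  imports "HOL-Probability.Probability"
begin

text \<open>Tensors of order \<open>k = CARD('k)\<close> over \<open>\<real>\<^sup>n\<close>, \<open>n = CARD('n)\<close>: a multi-index
  \<open>(i\<^sub>1, \<dots>, i\<^sub>k)\<close> is a function \<open>'k \<Rightarrow> 'n\<close>, so \<open>k \<ge> 1\<close> and \<open>n \<ge> 1\<close> are automatic.\<close>

type_synonym ('k, 'n) tensor = "real ^ ('k \<Rightarrow> 'n)"

definition tensor_power :: "real ^ 'n \<Rightarrow> ('k::finite, 'n::finite) tensor"
  where "tensor_power v = (\<chi> i. \<Prod>j\<in>UNIV. v $ i j)"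

definition iid_standard_normal :: "'a measure \<Rightarrow> ('a \<Rightarrow> ('k::finite, 'n::finite) tensor) \<Rightarrow> bool"
  where "iid_standard_normal M G \<longleftrightarrow>
    prob_space.indep_vars M (\<lambda>_. borel) (\<lambda>i \<omega>. G \<omega> $ i) UNIV \<and>
    (\<forall>i. distributed M lborel (\<lambda>\<omega>. G \<omega> $ i) (\<lambda>x. ennreal (std_normal_density x)))"

text \<open>The multi-index \<open>(i\<^bsub>\<pi>(1)\<^esub>, \<dots>, i\<^bsub>\<pi>(k)\<^esub>)\<close> is \<open>i \<circ> \<pi>\<close>.\<close>

definition symmetrize_noise :: "('k::finite, 'n::finite) tensor \<Rightarrow> ('k, 'n) tensor"
  where "symmetrize_noise G = (\<chi> i. 1 / fact CARD('k) * sqrt (real CARD('k) / real CARD('n)) *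
    (\<Sum>\<pi> | \<pi> permutes UNIV. G $ (i \<circ> \<pi>)))"

definition symmetric_standard_normal ::
    "'a measure \<Rightarrow> ('a \<Rightarrow> ('k::finite, 'n::finite) tensor) \<Rightarrow> bool"
  where "symmetric_standard_normal M Z \<longleftrightarrow>
    (\<exists>G. iid_standard_normal M G \<and> (\<forall>\<omega>\<in>space M. Z \<omega> = symmetrize_noise (G \<omega>)))"

definition loss :: "real ^ 'n::finite \<Rightarrow> real ^ 'n \<Rightarrow> real"
  where "loss u v = min ((norm (u - v))\<^sup>2) ((norm (u + v))\<^sup>2)"

end

theory Submission
  imports Defs
begin

text \<open>The risk is averaged over \<open>v\<^sub>0\<close> uniform on \<open>{\<plusminus>1/\<surd>n}\<^sup>n\<close>. Since the \<open>k\<close>-th tensor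
  power \<open>T\<close> of \<open>v\<^sub>0\<close> is fixed by symmetrization, the data are a function of the i.i.d. tensor
  \<open>G + a\<close> with \<open>a = \<beta> \<surd>(n/k) T\<close> and \<open>\<parallel>a\<parallel>\<^sup>2 = \<beta>\<^sup>2 n/k \<le> n/10\<close>. If \<open>L\<close> is the likelihood ratio
  of \<open>G + a\<close> to \<open>G\<close>, then \<open>E[L\<^sup>2] = exp \<parallel>a\<parallel>\<^sup>2\<close>, so Cauchy--Schwarz bounds the average
  probability of \<open>\<bar>\<langle>vhat, v\<^sub>0\<rangle>\<bar> \<ge> 9/10\<close> by \<open>exp (n/20) \<surd>q\<close>, where \<open>q\<close> bounds the proportion of
  hypercube points \<open>v\<close> with \<open>\<bar>\<langle>w, v\<rangle>\<bar> \<ge> 9/10\<close>, for any fixed unit vector \<open>w\<close>. The subgaussian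
  tail gives \<open>q = 2 exp (- n (9/10)\<^sup>2 / 2)\<close>. For \<open>n \<ge> 4\<close> the resulting probability is at most
  \<open>4/5\<close>, and outside that event the loss exceeds \<open>1/5\<close>.\<close>

section \<open>Product Gaussian laws and their likelihood ratios\<close>

abbreviation gaussian_law :: "('i \<Rightarrow> real) \<Rightarrow> ('i \<Rightarrow> real) measure"
  where "gaussian_law a \<equiv> \<Pi>\<^sub>M i\<in>UNIV. density lborel (\<lambda>x. ennreal (normal_density (a i) 1 x))"

lemma sets_gaussian_law: "sets (gaussian_law a) = sets (\<Pi>\<^sub>M i\<in>UNIV. borel)"
  by (intro sets_PiM_cong) auto

lemma prob_space_gaussian_law: "prob_space (gaussian_law a)"
  by (intro prob_space_PiM prob_space_normal_density) simp

text \<open>Both sides agree on boxes: there the indicator splits over the coordinates, so the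
  integral of a product becomes a product of integrals. Boxes determine a finite product of
  sigma-finite measures.\<close>

lemma PiM_density:
  assumes "finite I"
    and "\<And>i. sigma_finite_measure (M i)"
    and f: "\<And>i. f i \<in> borel_measurable (M i)"
    and "\<And>i. sigma_finite_measure (density (M i) (f i))"
  shows "(\<Pi>\<^sub>M i\<in>I. density (M i) (f i)) = density (\<Pi>\<^sub>M i\<in>I. M i) (\<lambda>x. \<Prod>i\<in>I. f i (x i))"
proof -
  interpret M: product_sigma_finite M using assms(2) by (simp add: product_sigma_finite_def)
  interpret D: product_sigma_finite "\<lambda>i. density (M i) (f i)"
    using assms(4) by (simp add: product_sigma_finite_def)
  note f[measurable]
  show ?thesis
  proof (rule D.PiM_eqI[symmetric])
    show "sets (density (\<Pi>\<^sub>M i\<in>I. M i) (\<lambda>x. \<Prod>i\<in>I. f i (x i)))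
        = sets (\<Pi>\<^sub>M i\<in>I. density (M i) (f i))"
      by (simp, intro sets_PiM_cong) auto
    fix A assume A: "\<And>i. i \<in> I \<Longrightarrow> A i \<in> sets (density (M i) (f i))"
    have "emeasure (density (\<Pi>\<^sub>M i\<in>I. M i) (\<lambda>x. \<Prod>i\<in>I. f i (x i))) (Pi\<^sub>E I A)
        = (\<integral>\<^sup>+x. (\<Prod>i\<in>I. f i (x i)) * indicator (Pi\<^sub>E I A) x \<partial>(\<Pi>\<^sub>M i\<in>I. M i))"
      using A \<open>finite I\<close> by (intro emeasure_density sets_PiM_I_finite) auto
    also have "\<dots> = (\<integral>\<^sup>+x. (\<Prod>i\<in>I. f i (x i) * indicator (A i) (x i)) \<partial>(\<Pi>\<^sub>M i\<in>I. M i))"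
    proof (rule nn_integral_cong)
      fix x assume "x \<in> space (\<Pi>\<^sub>M i\<in>I. M i)"
      then have "x \<in> Pi\<^sub>E I A \<longleftrightarrow> (\<forall>i\<in>I. x i \<in> A i)"
        by (auto simp: space_PiM PiE_iff)
      then have "indicator (Pi\<^sub>E I A) x = (\<Prod>i\<in>I. indicator (A i) (x i) :: ennreal)"
        using \<open>finite I\<close> by (auto simp: indicator_def prod_zero_iff)
      then show "(\<Prod>i\<in>I. f i (x i)) * indicator (Pi\<^sub>E I A) x
          = (\<Prod>i\<in>I. f i (x i) * indicator (A i) (x i))"
        by (simp add: prod.distrib)
    qed
    also have "\<dots> = (\<Prod>i\<in>I. \<integral>\<^sup>+x. f i x * indicator (A i) x \<partial>M i)"
      using A by (intro M.product_nn_integral_prod \<open>finite I\<close>) auto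
    also have "\<dots> = (\<Prod>i\<in>I. emeasure (density (M i) (f i)) (A i))"
      using A by (intro prod.cong refl emeasure_density[symmetric]) auto
    finally show "emeasure (density (\<Pi>\<^sub>M i\<in>I. M i) (\<lambda>x. \<Prod>i\<in>I. f i (x i))) (Pi\<^sub>E I A)
        = (\<Prod>i\<in>I. emeasure (density (M i) (f i)) (A i))" .
  qed fact
qed

text \<open>Completing the square; the exponential is the likelihood ratio of a unit-variance normal
  variable with mean \<open>a\<close> to one with mean 0.\<close>

lemma normal_density_shift:
  "normal_density 0 1 x * exp (a * x - a\<^sup>2 / 2) = normal_density a 1 x"
  by (simp add: normal_density_def mult_exp_exp power2_eq_square field_simps)

lemma density_normal_shift:
  "density (density lborel (\<lambda>x. ennreal (normal_density 0 1 x)))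
     (\<lambda>x. ennreal (exp (a * x - a\<^sup>2 / 2))) = density lborel (\<lambda>x. ennreal (normal_density a 1 x))"
  by (subst density_density_eq)
    (auto simp: normal_density_shift ennreal_mult[symmetric])

lemma gaussian_law_eq_density:
  fixes a :: "'i::finite \<Rightarrow> real"
  shows "gaussian_law a
    = density (gaussian_law (\<lambda>_. 0)) (\<lambda>x. ennreal (\<Prod>i\<in>UNIV. exp (a i * x i - (a i)\<^sup>2 / 2)))"
proof -
  have sf: "sigma_finite_measure (density lborel (\<lambda>x. ennreal (normal_density m 1 x)))" for m
    by (intro prob_space_imp_sigma_finite prob_space_normal_density) simp
  have "gaussian_law a = (\<Pi>\<^sub>M i\<in>UNIV. density (density lborel (\<lambda>x. ennreal (normal_density 0 1 x)))
      (\<lambda>x. ennreal (exp (a i * x - (a i)\<^sup>2 / 2))))"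
    by (simp only: density_normal_shift)
  also have "\<dots> = density (gaussian_law (\<lambda>_. 0))
      (\<lambda>x. \<Prod>i\<in>UNIV. ennreal (exp (a i * x i - (a i)\<^sup>2 / 2)))"
    by (rule PiM_density) (auto simp only: density_normal_shift sf, simp_all)
  finally show ?thesis by (simp add: prod_ennreal)
qed

text \<open>In each coordinate, completing the square turns the squared ratio times the null density
  into \<open>exp (m\<^sup>2)\<close> times the density with mean \<open>2 * m\<close>; independence
  multiplies these constants.\<close>

lemma nn_integral_likelihood_ratio_squared:
  fixes a :: "'i::finite \<Rightarrow> real"
  shows "(\<integral>\<^sup>+x. ennreal ((\<Prod>i\<in>UNIV. exp (a i * x i - (a i)\<^sup>2 / 2))\<^sup>2) \<partial>gaussian_law (\<lambda>_. 0))
    = ennreal (exp (\<Sum>i\<in>UNIV. (a i)\<^sup>2))"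
proof -
  let ?N = "density lborel (\<lambda>x. ennreal (normal_density 0 1 x))"
  have one: "(\<integral>\<^sup>+x. ennreal ((exp (m * x - m\<^sup>2 / 2))\<^sup>2) \<partial>?N) = ennreal (exp (m\<^sup>2))" for m
  proof -
    have "normal_density 0 1 x * (exp (m * x - m\<^sup>2 / 2))\<^sup>2
        = exp (m\<^sup>2) * normal_density (2 * m) 1 x" for x
      by (simp add: normal_density_def mult_exp_exp power2_eq_square field_simps)
    then have "(\<integral>\<^sup>+x. ennreal ((exp (m * x - m\<^sup>2 / 2))\<^sup>2) \<partial>?N)
        = (\<integral>\<^sup>+x. ennreal (exp (m\<^sup>2)) * ennreal (normal_density (2 * m) 1 x) \<partial>lborel)"
      by (subst nn_integral_density) (auto simp: ennreal_mult[symmetric])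
    also have "\<dots> = ennreal (exp (m\<^sup>2))
        * emeasure (density lborel (\<lambda>x. ennreal (normal_density (2 * m) 1 x))) UNIV"
      by (simp add: nn_integral_cmult emeasure_density)
    also have "emeasure (density lborel (\<lambda>x. ennreal (normal_density (2 * m) 1 x))) UNIV = 1"
      using prob_space.emeasure_space_1[OF prob_space_normal_density[of 1 "2 * m"]] by simp
    finally show ?thesis by simp
  qed
  interpret product_sigma_finite "\<lambda>_ :: 'i. ?N"
    by unfold_locales
      (intro sigma_finite_measure.sigma_finite_countable prob_space_imp_sigma_finite
        prob_space_normal_density, simp)
  have "(\<integral>\<^sup>+x. ennreal ((\<Prod>i\<in>UNIV. exp (a i * x i - (a i)\<^sup>2 / 2))\<^sup>2) \<partial>gaussian_law (\<lambda>_. 0))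
      = (\<integral>\<^sup>+x. (\<Prod>i\<in>UNIV. ennreal ((exp (a i * x i - (a i)\<^sup>2 / 2))\<^sup>2)) \<partial>gaussian_law (\<lambda>_. 0))"
    by (simp add: prod_ennreal prod_power_distrib)
  also have "\<dots> = (\<Prod>i\<in>UNIV. ennreal (exp ((a i)\<^sup>2)))"
    by (subst product_nn_integral_prod) (simp_all add: one)
  finally show ?thesis by (simp add: prod_ennreal exp_sum)
qed

text \<open>Linearity in the null probability of \<open>A\<close> is the point: for the events used
  later, only the sum of these probabilities over the signals is controlled. The last term comes
  from the second moment of the ratio, taken over the whole space instead of
  \<open>A\<close>.\<close>

lemma measure_gaussian_law_le:
  fixes a :: "'i::finite \<Rightarrow> real"
  assumes A: "A \<in> sets (\<Pi>\<^sub>M i\<in>UNIV. borel)" and "c > 0"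
  shows "measure (gaussian_law a) A
    \<le> c / 2 * measure (gaussian_law (\<lambda>_. 0)) A + exp (\<Sum>i\<in>UNIV. (a i)\<^sup>2) / (2 * c)"
proof -
  let ?P = "gaussian_law (\<lambda>_ :: 'i. 0)"
  interpret a: prob_space "gaussian_law a" by (rule prob_space_gaussian_law)
  interpret P: prob_space ?P by (rule prob_space_gaussian_law)
  define L where "L x = (\<Prod>i\<in>UNIV. exp (a i * x i - (a i)\<^sup>2 / 2))" for x
  have L_nonneg: "L x \<ge> 0" for x by (simp add: L_def prod_nonneg)
  have L_meas[measurable]: "L \<in> borel_measurable ?P"
    unfolding L_def by measurable
  have A'[measurable]: "A \<in> sets ?P" using A sets_gaussian_law[of "\<lambda>_ :: 'i. 0"] by simp
  have "ennreal (measure (gaussian_law a) A) = (\<integral>\<^sup>+x. ennreal (L x) * indicator A x \<partial>?P)"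
    unfolding a.emeasure_eq_measure[symmetric]
    by (subst gaussian_law_eq_density) (auto simp: L_def[symmetric] emeasure_density)
  also have "\<dots> \<le> (\<integral>\<^sup>+x. ennreal (c / 2) * indicator A x
      + ennreal (1 / (2 * c)) * ennreal ((L x)\<^sup>2) \<partial>?P)"
  proof (rule nn_integral_mono)
    fix x
    \<comment> \<open>Cauchy--Schwarz in AM-GM form; the optimal \<open>c\<close> is chosen after averaging over \<open>v\<^sub>0\<close>.\<close>
    have "0 \<le> (L x - c)\<^sup>2" by simp
    then have "L x \<le> c / 2 + 1 / (2 * c) * (L x)\<^sup>2"
      using \<open>c > 0\<close> by (simp add: field_simps power2_eq_square)
    then have "ennreal (L x) \<le> ennreal (c / 2) + ennreal (1 / (2 * c)) * ennreal ((L x)\<^sup>2)"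
      using \<open>c > 0\<close> by (subst ennreal_mult[symmetric], simp_all flip: ennreal_plus add: ennreal_leI)
    then show "ennreal (L x) * indicator A x \<le> ennreal (c / 2) * indicator A x
        + ennreal (1 / (2 * c)) * ennreal ((L x)\<^sup>2)"
      by (simp split: split_indicator)
  qed
  also have "\<dots> = ennreal (c / 2) * emeasure ?P A
      + ennreal (1 / (2 * c)) * ennreal (exp (\<Sum>i\<in>UNIV. (a i)\<^sup>2))"
    by (subst nn_integral_add)
      (auto simp: nn_integral_cmult L_def nn_integral_likelihood_ratio_squared)
  also have "\<dots> = ennreal (c / 2 * measure ?P A + exp (\<Sum>i\<in>UNIV. (a i)\<^sup>2) / (2 * c))"
    using \<open>c > 0\<close> by (simp add: P.emeasure_eq_measure ennreal_mult[symmetric] flip: ennreal_plus)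
  finally show ?thesis
    using \<open>c > 0\<close> by (subst (asm) ennreal_le_iff) auto
qed

section \<open>Subgaussian cap bounds on the hypercube\<close>

lemma cosh_le_exp_half_square:
  fixes x :: real
  shows "cosh x \<le> exp (x\<^sup>2 / 2)"
proof -
  have *: "cosh y \<le> exp (y\<^sup>2 / 2)" if "y \<ge> 0" for y :: real
  proof -
    \<comment> \<open>Hoeffding's lemma for a fair coin, \<open>p = 1/2\<close> and \<open>h = 2 y\<close>.\<close>
    have "ln (1 + 1 / 2 * (exp (2 * y) - 1)) \<le> y\<^sup>2 / 2 + y"
      using Hoeffdings_lemma_aux[of "2 * y" "1 / 2"] that by (simp add: power2_eq_square)
    then have "1 + 1 / 2 * (exp (2 * y) - 1) \<le> exp (y\<^sup>2 / 2 + y)"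
      using exp_gt_zero[of "2 * y"]
      by (subst ln_le_cancel_iff[symmetric]) (auto simp: algebra_simps add_pos_pos)
    moreover have "1 + 1 / 2 * (exp (2 * y) - 1) = cosh y * exp y"
      by (simp add: cosh_def exp_minus field_simps mult_exp_exp)
    ultimately show ?thesis by (simp add: exp_add)
  qed
  show ?thesis using *[of "\<bar>x\<bar>"] by (cases "x \<ge> 0") auto
qed


text \<open>Summing over all sign vectors factorizes into the product of
  \<open>2 * cosh (w $ j)\<close>; up to the factor \<open>2 ^ CARD('n)\<close> this is the moment
  generating function of a Rademacher sum.\<close>

lemma sum_exp_hypercube_le:
  fixes w :: "real ^ 'n::finite"
  shows "(\<Sum>f\<in>Pi\<^sub>E UNIV (\<lambda>_ :: 'n. {-1, 1}). exp (\<Sum>j\<in>UNIV. w $ j * f j))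
    \<le> 2 ^ CARD('n) * exp ((norm w)\<^sup>2 / 2)"
proof -
  have "(\<Sum>f\<in>Pi\<^sub>E UNIV (\<lambda>_ :: 'n. {-1, 1 :: real}). exp (\<Sum>j\<in>UNIV. w $ j * f j))
      = (\<Prod>j\<in>UNIV. \<Sum>s\<in>{-1, 1}. exp (w $ j * s))"
    by (subst prod_sum_PiE) (auto simp: exp_sum)
  also have "\<dots> = (\<Prod>j\<in>UNIV. 2 * cosh (w $ j))"
    by (intro prod.cong) (auto simp: cosh_def)
  also have "\<dots> \<le> (\<Prod>j\<in>UNIV. 2 * exp ((w $ j)\<^sup>2 / 2))"
    by (intro prod_mono) (auto simp: cosh_le_exp_half_square)
  also have "\<dots> = 2 ^ CARD('n) * exp ((norm w)\<^sup>2 / 2)"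
    by (simp add: prod.distrib exp_sum[symmetric] norm_vec_def L2_set_def sum_nonneg
        sum_divide_distrib)
  finally show ?thesis .
qed

text \<open>A finite set of signals standing in for the sphere: the scaling gives norm 1, and the
  parametrization by sign functions lets exponential sums factor over coordinates.\<close>

definition hypercube :: "(real ^ 'n::finite) set"
  where "hypercube = (\<lambda>f. \<chi> j. f j / sqrt (real CARD('n))) ` Pi\<^sub>E UNIV (\<lambda>_. {-1, 1})"

lemma inj_hypercube:
  "inj_on (\<lambda>f. \<chi> j. f j / sqrt (real CARD('n)) :: real ^ 'n::finite) X"
  by (auto simp: inj_on_def vec_eq_iff)

lemma finite_hypercube: "finite (hypercube :: (real ^ 'n::finite) set)"
  unfolding hypercube_def by (intro finite_imageI finite_PiE) auto

lemma card_hypercube: "card (hypercube :: (real ^ 'n::finite) set) = 2 ^ CARD('n)"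
  unfolding hypercube_def by (subst card_image[OF inj_hypercube]) (simp add: card_PiE numeral_2_eq_2)

lemma norm_hypercube:
  fixes v :: "real ^ 'n::finite"
  assumes "v \<in> hypercube"
  shows "norm v = 1"
proof -
  obtain f where f: "f \<in> Pi\<^sub>E UNIV (\<lambda>_. {-1, 1})" "v = (\<chi> j. f j / sqrt (real CARD('n)))"
    using assms by (auto simp: hypercube_def)
  have "(f j)\<^sup>2 = 1" for j using f(1) by (auto simp: PiE_iff Pi_iff power2_eq_1_iff)
  then show ?thesis
    by (simp add: f(2) norm_vec_def L2_set_def power_divide)
qed

text \<open>Chernoff's bound with parameter \<open>n * t\<close>, the minimizer of
  \<open>- l * t + l\<^sup>2 / (2 * n)\<close> over \<open>l\<close>. The leading 2 accounts for the
  caps around \<open>w\<close> and \<open>- w\<close>.\<close>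

lemma card_hypercube_cap_le:
  fixes w :: "real ^ 'n::finite"
  assumes "norm w = 1" and "t \<ge> 0"
  shows "real (card {v \<in> hypercube. \<bar>w \<bullet> v\<bar> \<ge> t})
    \<le> 2 * 2 ^ CARD('n) * exp (- (real CARD('n) * t\<^sup>2 / 2))"
proof -
  define n where "n = real CARD('n)"
  have n: "n > 0" by (simp add: n_def)
  have mgf: "(\<Sum>v\<in>hypercube. exp (n * t * (w' \<bullet> v))) \<le> 2 ^ CARD('n) * exp (n * t\<^sup>2 / 2)"
    if "norm w' = 1" for w' :: "real ^ 'n"
  proof -
    \<comment> \<open>As \<open>v $ j\<close> is a sign over \<open>sqrt n\<close>, the exponent
      pairs the sign vector with \<open>sqrt n * t\<close> times \<open>w'\<close>, whose squared
      norm is \<open>n * t\<^sup>2\<close>.\<close>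
    have "(\<Sum>v\<in>hypercube. exp (n * t * (w' \<bullet> v)))
        = (\<Sum>f\<in>Pi\<^sub>E UNIV (\<lambda>_ :: 'n. {-1, 1}). exp (\<Sum>j\<in>UNIV. ((sqrt n * t) *\<^sub>R w') $ j * f j))"
      unfolding hypercube_def
      using n by (subst sum.reindex[OF inj_hypercube])
        (auto simp: inner_vec_def sum_distrib_left n_def[symmetric] field_simps
          intro!: sum.cong arg_cong[where f = exp])
    also have "\<dots> \<le> 2 ^ CARD('n) * exp ((norm ((sqrt n * t) *\<^sub>R w'))\<^sup>2 / 2)"
      by (rule sum_exp_hypercube_le)
    finally show ?thesis using that n \<open>t \<ge> 0\<close> by (simp add: power_mult_distrib)
  qed
  have "real (card {v \<in> hypercube. \<bar>w \<bullet> v\<bar> \<ge> t}) = (\<Sum>v\<in>hypercube. of_bool (\<bar>w \<bullet> v\<bar> \<ge> t))"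
    by (simp add: finite_hypercube Int_def)
  \<comment> \<open>Inside either cap one of the two exponentials is at least
    \<open>exp (n * t\<^sup>2)\<close>, and the other is positive.\<close>
  also have "\<dots> \<le> (\<Sum>v\<in>hypercube. exp (- (n * t\<^sup>2))
      * (exp (n * t * (w \<bullet> v)) + exp (n * t * ((- w) \<bullet> v))))"
  proof (rule sum_mono)
    fix v :: "real ^ 'n"
    have "1 \<le> exp (- (n * t\<^sup>2)) * (exp (n * t * (w \<bullet> v)) + exp (n * t * ((- w) \<bullet> v)))"
      if "\<bar>w \<bullet> v\<bar> \<ge> t"
    proof -
      have "exp (n * t\<^sup>2) \<le> exp (n * t * \<bar>w \<bullet> v\<bar>)"
        using that n \<open>t \<ge> 0\<close> by (auto simp: power2_eq_square mult.assoc intro!: mult_left_mono)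
      also have "\<dots> \<le> exp (n * t * (w \<bullet> v)) + exp (n * t * ((- w) \<bullet> v))"
        by (cases "w \<bullet> v \<ge> 0") auto
      finally show ?thesis by (simp add: exp_minus field_simps)
    qed
    then show "of_bool (\<bar>w \<bullet> v\<bar> \<ge> t)
        \<le> exp (- (n * t\<^sup>2)) * (exp (n * t * (w \<bullet> v)) + exp (n * t * ((- w) \<bullet> v)))"
      by (simp add: of_bool_def)
  qed
  also have "\<dots> = exp (- (n * t\<^sup>2)) * ((\<Sum>v\<in>hypercube. exp (n * t * (w \<bullet> v)))
      + (\<Sum>v\<in>hypercube. exp (n * t * ((- w) \<bullet> v))))"
    by (simp only: sum.distrib sum_distrib_left distrib_left)
  also have "\<dots> \<le> exp (- (n * t\<^sup>2)) * (2 ^ CARD('n) * exp (n * t\<^sup>2 / 2)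
      + 2 ^ CARD('n) * exp (n * t\<^sup>2 / 2))"
    using mgf[of w] mgf[of "- w"] assms by (intro mult_left_mono add_mono) auto
  also have "\<dots> = 2 * 2 ^ CARD('n) * exp (- (n * t\<^sup>2 / 2))"
  proof -
    have "exp (- (n * t\<^sup>2 / 2)) = exp (- (n * t\<^sup>2)) * exp (n * t\<^sup>2 / 2)"
      by (simp add: mult_exp_exp)
    then show ?thesis by simp
  qed
  finally show ?thesis by (simp add: n_def)
qed

section \<open>Tensor powers and symmetrized noise\<close>

lemma sum_tensor_power_squared:
  fixes v :: "real ^ 'n::finite"
  assumes "norm v = 1"
  shows "(\<Sum>i\<in>UNIV. ((tensor_power v :: ('k::finite, 'n) tensor) $ i)\<^sup>2) = 1"
proof -
  \<comment> \<open>The sum over multi-indices of a product of squares is the \<open>k\<close>-th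
    power of the squared norm of \<open>v\<close>.\<close>
  have "(\<Sum>i\<in>UNIV. ((tensor_power v :: ('k, 'n) tensor) $ i)\<^sup>2)
      = (\<Sum>i\<in>Pi\<^sub>E (UNIV :: 'k set) (\<lambda>_. UNIV). \<Prod>j\<in>UNIV. (v $ i j)\<^sup>2)"
    by (simp add: tensor_power_def prod_power_distrib)
  also have "\<dots> = (\<Prod>j\<in>(UNIV :: 'k set). \<Sum>m\<in>UNIV. (v $ m)\<^sup>2)"
    using prod_sum_PiE[of "UNIV :: 'k set" "\<lambda>_. UNIV" "\<lambda>_ m. (v $ m)\<^sup>2"] by simp
  also have "(\<Sum>m\<in>UNIV. (v $ m)\<^sup>2) = 1"
    using assms by (simp add: norm_vec_def L2_set_def)
  finally show ?thesis by simp
qed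

lemma tensor_power_permute:
  assumes "\<pi> permutes UNIV"
  shows "tensor_power v $ (i \<circ> \<pi>) = tensor_power v $ i"
  unfolding tensor_power_def
  using prod.permute[OF assms, of "\<lambda>j. v $ i j"] by (simp add: o_def)

text \<open>Each of the \<open>k!\<close> permuted copies of a tensor power is the tensor power
  itself, so symmetrization only scales it by \<open>sqrt (k / n)\<close>, and dividing \<beta> by
  this factor moves the signal inside. The data become a function of independent entries, and no
  density for symmetric tensors is needed.\<close>

lemma symmetrize_noise_add_tensor_power:
  fixes G :: "('k::finite, 'n::finite) tensor"
  shows "\<beta> *\<^sub>R tensor_power v + symmetrize_noise G
    = symmetrize_noise (G + (\<beta> / sqrt (real CARD('k) / real CARD('n))) *\<^sub>R tensor_power v)"
proof -
  have "(\<Sum>\<pi> | \<pi> permutes (UNIV :: 'k set). tensor_power v $ (i \<circ> \<pi>))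
      = fact CARD('k) * tensor_power v $ i" for i :: "'k \<Rightarrow> 'n"
    by (simp add: tensor_power_permute card_permutations)
  then show ?thesis
    by (simp add: symmetrize_noise_def vec_eq_iff sum.distrib sum_divide_distrib[symmetric]
        sum_distrib_left[symmetric] algebra_simps)
qed

lemma borel_measurable_symmetrize_noise:
  "(\<lambda>x. symmetrize_noise (\<chi> i. x i) :: ('k::finite, 'n::finite) tensor)
    \<in> borel_measurable (\<Pi>\<^sub>M i\<in>UNIV. borel)"
  by (rule borel_measurable_euclidean_space[THEN iffD2])
    (auto simp: Basis_vec_def inner_axis symmetrize_noise_def)

lemma measurable_shifted_iid_standard_normal:
  fixes G :: "'a \<Rightarrow> ('k::finite, 'n::finite) tensor"
  assumes "iid_standard_normal M G"
  shows "(\<lambda>\<omega> i. G \<omega> $ i + a i) \<in> measurable M (\<Pi>\<^sub>M i\<in>UNIV. borel)"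
proof -
  have [measurable]: "(\<lambda>\<omega>. G \<omega> $ i) \<in> borel_measurable M" for i
    using assms distributed_measurable[of M lborel "\<lambda>\<omega>. G \<omega> $ i"]
    by (auto simp: iid_standard_normal_def)
  show ?thesis by (intro measurable_PiM_single') (auto simp: space_PiM)
qed

text \<open>Independence survives coordinatewise shifts and makes the joint law the product of its
  marginals, each a translated standard normal.\<close>

lemma (in prob_space) distr_shifted_iid_standard_normal:
  fixes G :: "'a \<Rightarrow> ('k::finite, 'n::finite) tensor"
  assumes "iid_standard_normal M G"
  shows "distr M (\<Pi>\<^sub>M i\<in>UNIV. borel) (\<lambda>\<omega> i. G \<omega> $ i + a i) = gaussian_law a"
proof -
  have indep: "indep_vars (\<lambda>_. borel) (\<lambda>i \<omega>. G \<omega> $ i) UNIV"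
    and G: "\<And>i. distributed M lborel (\<lambda>\<omega>. G \<omega> $ i) (\<lambda>x. ennreal (normal_density 0 1 x))"
    using assms by (auto simp: iid_standard_normal_def)
  have [measurable]: "(\<lambda>\<omega>. G \<omega> $ i) \<in> borel_measurable M" for i
    using distributed_measurable[OF G, of i] by simp
  have "indep_vars (\<lambda>_. borel) (\<lambda>i \<omega>. G \<omega> $ i + a i) UNIV"
    by (rule indep_vars_compose2[OF indep, where Y = "\<lambda>i x. x + a i"]) simp
  then have "distr M (\<Pi>\<^sub>M i\<in>UNIV. borel) (\<lambda>\<omega> i. G \<omega> $ i + a i)
      = (\<Pi>\<^sub>M i\<in>UNIV. distr M borel (\<lambda>\<omega>. G \<omega> $ i + a i))"
    by (subst (asm) indep_vars_iff_distr_eq_PiM) (auto simp: restrict_UNIV)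
  also have "(\<lambda>i. distr M borel (\<lambda>\<omega>. G \<omega> $ i + a i))
      = (\<lambda>i. density lborel (\<lambda>x. ennreal (normal_density (a i) 1 x)))"
  proof
    fix i
    have "distributed M lborel (\<lambda>\<omega>. a i + 1 * G \<omega> $ i)
        (\<lambda>x. ennreal (normal_density (a i + 1 * 0) (\<bar>1\<bar> * 1) x))"
      by (intro normal_density_affine G) auto
    then show "distr M borel (\<lambda>\<omega>. G \<omega> $ i + a i)
        = density lborel (\<lambda>x. ennreal (normal_density (a i) 1 x))"
      by (auto simp: distributed_def add.commute cong: distr_cong)
  qed
  finally show ?thesis .
qed

section \<open>Loss of unit vectors and the numerical constants\<close>

lemma loss_unit:
  assumes "norm u = 1" and "norm v = 1"
  shows "loss u v = 2 - 2 * \<bar>u \<bullet> v\<bar>"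
  using assms
  by (simp add: loss_def power2_norm_eq_inner inner_simps norm_eq_1 inner_commute min_def abs_if)

lemma exp_sqrt_cap_bound_le:
  assumes "n \<ge> (4 :: nat)"
  shows "exp (real n / 20) * sqrt (2 * exp (- (real n * (9 / 10)\<^sup>2 / 2))) \<le> 4 / 5"
proof -
  \<comment> \<open>The exponents combine to \<open>1/20 - 81/400 = - 61/400\<close> per
    dimension.\<close>
  have "exp (real n / 20) * sqrt (2 * exp (- (real n * (9 / 10)\<^sup>2 / 2)))
      = sqrt 2 * exp (- (61 / 400 * real n))"
  proof -
    have "sqrt (exp (- (real n * (9 / 10)\<^sup>2 / 2))) = exp (- (81 / 400 * real n))"
      by (intro real_sqrt_unique) (simp_all add: power2_eq_square mult_exp_exp)
    then show ?thesis by (simp add: real_sqrt_mult mult_exp_exp)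
  qed
  \<comment> \<open>The expression decreases in \<open>n\<close>, so \<open>n = 4\<close> is the
    worst case.\<close>
  also have "\<dots> \<le> sqrt 2 * exp (- (61 / 100))" using assms by simp
  also have "\<dots> \<le> sqrt 2 * (1 / (1 + 61 / 100 + (61 / 100)\<^sup>2 / 2))"
  proof -
    have "1 + 61 / 100 + (61 / 100)\<^sup>2 / 2 \<le> exp (61 / 100 :: real)"
      by (rule exp_lower_Taylor_quadratic) simp
    then show ?thesis by (simp add: exp_minus field_simps)
  qed
  also have "\<dots> \<le> 4 / 5"
  proof -
    have "sqrt 2 \<le> (1.4143 :: real)" by (rule real_le_lsqrt) (simp_all add: power2_eq_square)
    then show ?thesis by (simp add: power2_eq_square)
  qed
  finally show ?thesis .
qed

section \<open>Averaging the success probability over the signals\<close>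

lemma average_cap_probability_le:
  fixes h :: "('i::finite \<Rightarrow> real) \<Rightarrow> real ^ 'n::finite" and a :: "real ^ 'n \<Rightarrow> 'i \<Rightarrow> real"
  assumes h[measurable]: "h \<in> borel_measurable (\<Pi>\<^sub>M i\<in>UNIV. borel)"
    and norm_h: "\<And>x. norm (h x) = 1"
    and a: "\<And>v. v \<in> hypercube \<Longrightarrow> (\<Sum>i\<in>UNIV. (a v i)\<^sup>2) \<le> s"
    and t: "t \<ge> 0"
  shows "(\<Sum>v\<in>hypercube. measure (gaussian_law (a v)) {x. \<bar>h x \<bullet> v\<bar> \<ge> t})
    \<le> 2 ^ CARD('n) * (exp (s / 2) * sqrt (2 * exp (- (real CARD('n) * t\<^sup>2 / 2))))"
proof -
  define N where "N = (2 :: real) ^ CARD('n)"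
  define q where "q = 2 * exp (- (real CARD('n) * t\<^sup>2 / 2))"
  \<comment> \<open>This minimizes \<open>c * q / 2 + exp s / (2 * c)\<close>: both terms become
    half of \<open>exp (s / 2) * sqrt q\<close>.\<close>
  define c where "c = exp (s / 2) / sqrt q"
  let ?P = "gaussian_law (\<lambda>_ :: 'i. 0)"
  let ?A = "\<lambda>v. {x. \<bar>h x \<bullet> v\<bar> \<ge> t}"
  have q: "q > 0" and c: "c > 0" by (simp_all add: q_def c_def)
  interpret P: prob_space ?P by (rule prob_space_gaussian_law)
  have space: "space (\<Pi>\<^sub>M i\<in>(UNIV :: 'i set). (borel :: real measure)) = UNIV"
    by (simp add: space_PiM)
  have A: "?A v \<in> sets (\<Pi>\<^sub>M i\<in>UNIV. borel)" for v
  proof -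
    have "{x \<in> space (\<Pi>\<^sub>M i\<in>UNIV. borel). \<bar>h x \<bullet> v\<bar> \<ge> t} \<in> sets (\<Pi>\<^sub>M i\<in>UNIV. borel)"
      by measurable
    then show ?thesis by (simp add: space)
  qed
  then have AP: "?A v \<in> sets ?P" for v by (simp add: sets_gaussian_law)
  \<comment> \<open>Under the null law the data carry no signal: for each fixed \<open>x\<close> the
    estimate \<open>h x\<close> is a single unit vector, and the inner sum counts the hypercube
    points in its two caps.\<close>
  have "(\<Sum>v\<in>hypercube. measure ?P (?A v))
      = (\<integral>x. (\<Sum>v\<in>hypercube. indicator (?A v) x) \<partial>?P)"
    using AP by (subst Bochner_Integration.integral_sum) (auto simp: P.emeasure_eq_measure)
  also have "\<dots> \<le> (\<integral>x. N * q \<partial>?P)"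
  proof (rule integral_mono)
    fix x
    have "(\<Sum>v\<in>hypercube. indicator (?A v) x) = real (card {v \<in> hypercube. \<bar>h x \<bullet> v\<bar> \<ge> t})"
      by (simp add: finite_hypercube indicator_def Int_def)
    also have "\<dots> \<le> N * q"
      using card_hypercube_cap_le[OF norm_h t, of x] by (simp add: N_def q_def)
    finally show "(\<Sum>v\<in>hypercube. indicator (?A v) x) \<le> N * q" .
  qed (use AP in \<open>auto simp: P.emeasure_eq_measure\<close>)
  finally have null: "(\<Sum>v\<in>hypercube. measure ?P (?A v)) \<le> N * q"
    using P.prob_space by simp
  have "(\<Sum>v\<in>hypercube. measure (gaussian_law (a v)) (?A v))
      \<le> (\<Sum>v\<in>hypercube. c / 2 * measure ?P (?A v) + exp s / (2 * c))"
  proof (rule sum_mono)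
    fix v :: "real ^ 'n" assume "v \<in> hypercube"
    then have "exp (\<Sum>i\<in>UNIV. (a v i)\<^sup>2) / (2 * c) \<le> exp s / (2 * c)"
      using c a by (intro divide_right_mono) auto
    with measure_gaussian_law_le[OF A c, of "a v" v]
    show "measure (gaussian_law (a v)) (?A v) \<le> c / 2 * measure ?P (?A v) + exp s / (2 * c)"
      by linarith
  qed
  also have "\<dots> = c / 2 * (\<Sum>v\<in>hypercube. measure ?P (?A v)) + N * (exp s / (2 * c))"
    by (simp add: sum.distrib sum_distrib_left card_hypercube N_def)
  also have "\<dots> \<le> c / 2 * (N * q) + N * (exp s / (2 * c))"
    using null c by (intro add_right_mono mult_left_mono) auto
  also have "\<dots> = N * (exp (s / 2) * sqrt q)"
  proof -
    have "c * q = exp (s / 2) * sqrt q"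
      using q by (simp add: c_def field_simps)
    moreover have "exp s / c = exp (s / 2) * sqrt q"
      using q by (simp add: c_def field_simps mult_exp_exp)
    moreover have "c / 2 * (N * q) + N * (exp s / (2 * c)) = N * ((c * q + exp s / c) / 2)"
      using c by (simp add: field_simps)
    ultimately show ?thesis by simp
  qed
  finally show ?thesis by (simp add: N_def q_def)
qed

section \<open>The lower bound on the risk at one hypercube point\<close>

theorem theorem1:
  fixes M :: "'a measure"
    and Z :: "'a \<Rightarrow> ('k::finite, 'n::finite) tensor"
    and vhat :: "('k, 'n) tensor \<Rightarrow> real ^ 'n"
    and \<beta> :: real
  assumes "prob_space M"
    and "symmetric_standard_normal M Z"
    and "vhat \<in> borel_measurable borel"
    and "\<And>X. norm (vhat X) = 1"
    and "CARD('n) \<ge> 4"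
    and "\<beta> \<ge> 0"
    and "\<beta> \<le> sqrt (real CARD('k) / 10)"
  shows "\<exists>v\<^sub>0. norm v\<^sub>0 = 1 \<and>
    (LINT \<omega>|M. loss (vhat (\<beta> *\<^sub>R tensor_power v\<^sub>0 + Z \<omega>)) v\<^sub>0) \<ge> 1 / 32"
proof -
  interpret prob_space M by fact
  obtain G where G: "iid_standard_normal M G"
    and Z: "\<And>\<omega>. \<omega> \<in> space M \<Longrightarrow> Z \<omega> = symmetrize_noise (G \<omega>)"
    using assms(2) by (auto simp: symmetric_standard_normal_def)
  define n k where "n = real CARD('n)" and "k = real CARD('k)"
  have n: "n > 0" and k: "k > 0" by (simp_all add: n_def k_def)
  define a where "a v i = \<beta> / sqrt (k / n) * tensor_power v $ i"
    for v :: "real ^ 'n" and i :: "'k \<Rightarrow> 'n"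
  \<comment> \<open>The estimator read as a function of the unsymmetrized tensor, whose law is a
    product measure.\<close>
  define h where "h x = vhat (symmetrize_noise (\<chi> i. x i))" for x :: "('k \<Rightarrow> 'n) \<Rightarrow> real"
  have h[measurable]: "h \<in> borel_measurable (\<Pi>\<^sub>M i\<in>UNIV. borel)"
    unfolding h_def by (rule measurable_compose[OF borel_measurable_symmetrize_noise assms(3)])
  have a_le: "(\<Sum>i\<in>UNIV. (a v i)\<^sup>2) \<le> n / 10" if "v \<in> hypercube" for v
  proof -
    have "\<beta>\<^sup>2 \<le> k / 10"
      using assms(6,7) k real_le_rsqrt by (metis k_def real_sqrt_le_iff real_sqrt_abs abs_of_nonneg)
    then have "\<beta>\<^sup>2 * n / k \<le> n / 10" using n k by (simp add: field_simps)
    moreover have "(\<Sum>i\<in>UNIV. (a v i)\<^sup>2) = \<beta>\<^sup>2 * n / k"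
      unfolding a_def power_mult_distrib sum_distrib_left[symmetric]
        sum_tensor_power_squared[OF norm_hypercube[OF that]]
      using n k by (simp add: power_divide)
    ultimately show ?thesis by simp
  qed
  have "(\<Sum>v\<in>hypercube. measure (gaussian_law (a v)) {x. \<bar>h x \<bullet> v\<bar> \<ge> 9 / 10})
      \<le> 2 ^ CARD('n) * (exp (n / 10 / 2) * sqrt (2 * exp (- (real CARD('n) * (9 / 10)\<^sup>2 / 2))))"
    by (rule average_cap_probability_le[OF h _ a_le]) (simp_all add: h_def assms(4))
  also have "\<dots> \<le> 2 ^ CARD('n) * (4 / 5)"
    using exp_sqrt_cap_bound_le[OF assms(5)] by (simp add: n_def)
  finally have avg: "(\<Sum>v\<in>hypercube. measure (gaussian_law (a v)) {x. \<bar>h x \<bullet> v\<bar> \<ge> 9 / 10})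
      \<le> (\<Sum>v\<in>(hypercube :: (real ^ 'n) set). 4 / 5)"
    by (simp add: card_hypercube)
  \<comment> \<open>Were the probability above 4/5 at every hypercube point, the sum would exceed
    the bound \<open>avg\<close>; strictness of the sum needs a nonempty hypercube.\<close>
  have "(hypercube :: (real ^ 'n) set) \<noteq> {}"
    using card_hypercube[where 'n = 'n] by fastforce
  then obtain v where v: "v \<in> hypercube"
    and le: "measure (gaussian_law (a v)) {x. \<bar>h x \<bullet> v\<bar> \<ge> 9 / 10} \<le> 4 / 5"
    using avg sum_strict_mono[OF finite_hypercube] by (metis (no_types, lifting) linorder_not_less)
  define X where "X \<omega> i = G \<omega> $ i + a v i" for \<omega> i
  define A where "A = {x. \<bar>h x \<bullet> v\<bar> \<ge> 9 / 10}"
  have X[measurable]: "X \<in> measurable M (\<Pi>\<^sub>M i\<in>UNIV. borel)"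
    unfolding X_def by (rule measurable_shifted_iid_standard_normal[OF G])
  have "{x \<in> space (\<Pi>\<^sub>M i\<in>UNIV. borel). \<bar>h x \<bullet> v\<bar> \<ge> 9 / 10} \<in> sets (\<Pi>\<^sub>M i\<in>UNIV. borel)"
    by measurable
  then have A[measurable]: "A \<in> sets (\<Pi>\<^sub>M i\<in>UNIV. borel)"
    by (simp add: A_def space_PiM)
  have "measure (gaussian_law (a v)) A = prob (X -` A \<inter> space M)"
    unfolding distr_shifted_iid_standard_normal[OF G, of "a v", symmetric] X_def[symmetric]
    by (rule measure_distr[OF X A])
  with le have prob_A: "prob (X -` A \<inter> space M) \<le> 4 / 5" by (simp add: A_def)
  have vhat: "vhat (\<beta> *\<^sub>R tensor_power v + Z \<omega>) = h (X \<omega>)" if "\<omega> \<in> space M" for \<omega>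
  proof -
    have "(\<chi> i. X \<omega> i) = G \<omega> + (\<beta> / sqrt (k / n)) *\<^sub>R tensor_power v"
      by (simp add: vec_eq_iff X_def a_def)
    then show ?thesis
      by (simp add: h_def Z[OF that] symmetrize_noise_add_tensor_power k_def n_def)
  qed
  have norm_h: "norm (h x) = 1" for x by (simp add: h_def assms(4))
  have norm_v: "norm v = 1" using v by (rule norm_hypercube)
  have bound: "\<bar>h x \<bullet> v\<bar> \<le> 1" for x
    using Cauchy_Schwarz_ineq2[of "h x" v] by (simp add: norm_h norm_v)
  \<comment> \<open>The right-hand side is at least \<open>1/5 * (1 - 4/5) = 1/25\<close>.\<close>
  have "1 / 32 \<le> 1 / 5 * (1 - prob (X -` A \<inter> space M))" using prob_A by simp
  also have "\<dots> = (LINT \<omega>|M. 1 / 5 * (1 - indicator (X -` A \<inter> space M) \<omega>))"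
    by (subst integral_mult_right_zero, subst Bochner_Integration.integral_diff)
      (auto simp: prob_space emeasure_eq_measure)
  \<comment> \<open>Off the event the loss exceeds \<open>2 - 2 * 9/10 = 1/5\<close>; on it the left
    integrand is 0, and Cauchy--Schwarz keeps the loss nonnegative.\<close>
  also have "\<dots> \<le> (LINT \<omega>|M. 2 - 2 * \<bar>h (X \<omega>) \<bullet> v\<bar>)"
  proof (rule integral_mono)
    show "integrable M (\<lambda>\<omega>. 2 - 2 * \<bar>h (X \<omega>) \<bullet> v\<bar>)"
      using bound by (intro integrable_const_bound[where B = 2]) auto
    show "1 / 5 * (1 - indicator (X -` A \<inter> space M) \<omega>) \<le> 2 - 2 * \<bar>h (X \<omega>) \<bullet> v\<bar>"
      if "\<omega> \<in> space M" for \<omega>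
      using that bound[of "X \<omega>"] by (auto simp: A_def split: split_indicator)
  qed (auto simp: emeasure_eq_measure)
  also have "\<dots> = (LINT \<omega>|M. loss (vhat (\<beta> *\<^sub>R tensor_power v + Z \<omega>)) v)"
    by (rule Bochner_Integration.integral_cong) (simp_all add: vhat loss_unit norm_h norm_v)
  finally show ?thesis using norm_v by blast
qed

end
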